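(* Fix $m,q\in\mathbb{N}$ such that $m-q-1\geq0$, and let $a\in\mathbb{C}$. If the Toeplitz operator $T_{\varphi}$ on $A^2(\mathbb{D})$ with symbol $\varphi(z)=z^m\bar{z}^{m-1}+a\bar{z}^{m-q}z^{m-q-1}$ is hyponormal, then \[ |a|\leq\frac{m-q+1}{m+1}. \]
   Context: $\mathbb{N}$ denotes the positive integers. $\mathbb{D}$ is the open unit disk in $\mathbb{C}$ and $dA$ is normalized area measure on $\mathbb{D}$. The Bergman space $A^2(\mathbb{D})$ is the Hilbert space of analytic functions $f$ on $\mathbb{D}$ with $\int_{\mathbb{D}}|f|^2\,dA<\infty$, with inner product $\langle f,g\rangle=\int_{\mathbb{D}}f\bar{g}\,dA$. For $\varphi\in L^{\infty}(\mathbb{D})$, the Toeplitz operator $T_{\varphi}:A^2(\mathbb{D})\rightarrow A^2(\mathbb{D})$ is defined by $T_{\varphi}(f)=P(\varphi f)$, where $P:L^2(\mathbb{D},dA)\rightarrow A^2(\mathbb{D})$ is the orthogonal projection. A bounded operator $T$ on a Hilbert space is hyponormal if $[T^*,T]=T^*T-TT^*\geq0$. *)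

theory Defs
  imports "HOL-Analysis.Analysis"
begin

abbreviation unit_disk :: "complex set" where
  "unit_disk \<equiv> ball 0 1"

text \<open>The measure lives on all of the complex plane but is concentrated on the disk, so values of
  functions outside the disk do not affect integrals.\<close>

definition disk_area :: "complex measure" where
  "disk_area = uniform_measure lborel unit_disk"

definition ip :: "(complex \<Rightarrow> complex) \<Rightarrow> (complex \<Rightarrow> complex) \<Rightarrow> complex" where
  "ip f g = (LINT z|disk_area. f z * cnj (g z))"

text \<open>An analytic function on the disk is represented by its extension by 0 to the plane. Equality
  of elements of the space is then equality of functions, so the objects described by
  \<^term>\<open>The\<close> below are unique.\<close>

definition bergman_space :: "(complex \<Rightarrow> complex) set" where
  "bergman_space = {f. f holomorphic_on unit_disk \<and> (\<forall>z. z \<notin> unit_disk \<longrightarrow> f z = 0) \<and>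
     integrable disk_area (\<lambda>z. (cmod (f z))\<^sup>2)}"

text \<open>The orthogonal projection from square-integrable functions onto the Bergman space: the element
  \<open>g\<close> for which \<open>f - g\<close> is orthogonal to the space. It is meaningful for square-integrable
  \<open>f\<close> only.\<close>

definition bergman_proj :: "(complex \<Rightarrow> complex) \<Rightarrow> complex \<Rightarrow> complex" where
  "bergman_proj f = (THE g. g \<in> bergman_space \<and> (\<forall>h\<in>bergman_space. ip (\<lambda>z. f z - g z) h = 0))"

definition toeplitz :: "(complex \<Rightarrow> complex) \<Rightarrow> (complex \<Rightarrow> complex) \<Rightarrow> complex \<Rightarrow> complex" where
  "toeplitz \<phi> f = bergman_proj (\<lambda>z. \<phi> z * f z)"

text \<open>Operators are functions on functions, of which only the action on \<^const>\<open>bergman_space\<close>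
  matters. The Hilbert space adjoint is meaningful for bounded \<open>T\<close>, such as Toeplitz operators
  with bounded symbol.\<close>

definition adj :: "((complex \<Rightarrow> complex) \<Rightarrow> complex \<Rightarrow> complex) \<Rightarrow> (complex \<Rightarrow> complex) \<Rightarrow> complex \<Rightarrow> complex" where
  "adj T g = (THE u. u \<in> bergman_space \<and> (\<forall>f\<in>bergman_space. ip (T f) g = ip f u))"

definition commutator ::
  "((complex \<Rightarrow> complex) \<Rightarrow> complex \<Rightarrow> complex) \<Rightarrow> ((complex \<Rightarrow> complex) \<Rightarrow> complex \<Rightarrow> complex) \<Rightarrow>
   (complex \<Rightarrow> complex) \<Rightarrow> complex \<Rightarrow> complex" where
  "commutator S T f = (\<lambda>z. S (T f) z - T (S f) z)"

definition positive_operator :: "((complex \<Rightarrow> complex) \<Rightarrow> complex \<Rightarrow> complex) \<Rightarrow> bool" where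
  "positive_operator A \<longleftrightarrow> (\<forall>f\<in>bergman_space. ip (A f) f \<in> \<real>\<^sub>\<ge>\<^sub>0)"

definition hyponormal :: "((complex \<Rightarrow> complex) \<Rightarrow> complex \<Rightarrow> complex) \<Rightarrow> bool" where
  "hyponormal T \<longleftrightarrow> positive_operator (commutator (adj T) T)"

end

theory Submission
  imports Defs "HOL-Complex_Analysis.Complex_Analysis" "HOL-Probability.Distributions"
begin

text \<open>For a Toeplitz operator \<open>T\<close> with bounded symbol \<open>p\<close>, the adjoint is the Toeplitz operator with
  symbol \<open>cnj p\<close>, so hyponormality says that the norm of \<open>T* f\<close> is at most that of \<open>T f\<close> for every
  \<open>f\<close> in the Bergman space (\<open>hyponormal_toeplitz_norm_le\<close>). The bound comes from the single test
  function \<open>f = 1\<close>. Under rotations the first term of the symbol has degree 1 and the second degree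
  -1. Projecting a monomial of degree 1 gives a multiple of \<open>z\<close>, and one of degree -1 projects to 0,
  so \<open>T 1 = 2 / (m + 1) * z\<close>. In the conjugate symbol the two terms exchange their roles, so
  \<open>T* 1 = 2 * cnj a / (m - q + 1) * z\<close> (both are instances of \<open>toeplitz_disk_monomial_0\<close>). Comparing norms is
  the claim.

  The analytic work is in making these formulas meaningful. The projection must be shown to exist
  for arbitrary square-integrable functions, since the adjoint is characterized by testing against the
  whole space. This is done by minimizing the distance; the essential input is that point
  evaluations are bounded on the Bergman space (\<open>bergman_point_evaluation\<close>), which makes limits in norm
  holomorphic. Both this bound and the projections of monomials come from one weighted mean value
  property (\<open>radial_mean_value\<close>), which combines rotation invariance of area measure with Cauchy's
  integral formula.\<close>

section \<open>Rotation invariance of area measure\<close>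

lemma nn_integral_lborel_shift:
  fixes t :: "'a :: euclidean_space"
  assumes [measurable]: "g \<in> borel_measurable borel"
  shows "(\<integral>\<^sup>+x. g (t + x) \<partial>lborel) = (\<integral>\<^sup>+x. g x \<partial>lborel)"
proof -
  have "(\<integral>\<^sup>+x. g x \<partial>lborel) = (\<integral>\<^sup>+x. g x \<partial>distr lborel borel ((+) t))"
    by (simp add: lborel_distr_plus)
  also have "\<dots> = (\<integral>\<^sup>+x. g (t + x) \<partial>lborel)"
    by (subst nn_integral_distr) auto
  finally show ?thesis ..
qed

text \<open>Multiplication by \<open>c\<close> carries Lebesgue measure to another translation-invariant measure, and
  locally finite translation-invariant measures are proportional; the factor is 1 because the unit ball is mapped
  to itself. The proof runs Fubini on the product of the indicator of the set with that of a
  shifted unit ball, which gives proportionality and the factor in one computation.\<close>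

lemma distr_lborel_mult_unimodular:
  fixes c :: complex
  assumes c: "cmod c = 1"
  shows "distr lborel borel ((*) c) = lborel"
proof (rule measure_eqI)
  fix A :: "complex set" assume "A \<in> sets (distr lborel borel ((*) c))"
  then have A[measurable]: "A \<in> sets borel" by simp
  define B :: "complex set" where "B = ball 0 1"
  have B[measurable]: "B \<in> sets borel" by (simp add: B_def)
  have c0: "c \<noteq> 0" using c by auto
  let ?a = "\<lambda>x. indicator A x :: ennreal" and ?b = "\<lambda>x. indicator B x :: ennreal"
  have "emeasure (distr lborel borel ((*) c)) A * emeasure lborel B = (\<integral>\<^sup>+x. ?a (c * x) * emeasure lborel B \<partial>lborel)"
    by (subst nn_integral_multc) (auto simp: nn_integral_indicator[symmetric] nn_integral_distr simp del: nn_integral_indicator)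
  also have "\<dots> = (\<integral>\<^sup>+x. (\<integral>\<^sup>+y. ?a (c * x) * ?b (- (c * x) + y) \<partial>lborel) \<partial>lborel)"
  proof (rule nn_integral_cong)
    fix x
    have "(\<integral>\<^sup>+y. ?b (- (c * x) + y) \<partial>lborel) = emeasure lborel B"
      by (subst nn_integral_lborel_shift) auto
    then show "?a (c * x) * emeasure lborel B = (\<integral>\<^sup>+y. ?a (c * x) * ?b (- (c * x) + y) \<partial>lborel)"
      by (subst nn_integral_cmult) auto
  qed
  also have "\<dots> = (\<integral>\<^sup>+y. (\<integral>\<^sup>+x. ?a (c * x) * ?b (- (c * x) + y) \<partial>lborel) \<partial>lborel)"
    by (rule lborel_pair.Fubini'[symmetric]) measurable
  \<comment> \<open>Shift the inner variable by \<open>y / c\<close>; the ball is symmetric and invariant under \<open>c\<close>.\<close>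
  also have "\<dots> = (\<integral>\<^sup>+y. (\<integral>\<^sup>+x. ?a (c * x + y) * ?b x \<partial>lborel) \<partial>lborel)"
  proof (rule nn_integral_cong)
    fix y
    have "(\<integral>\<^sup>+x. ?a (c * x) * ?b (- (c * x) + y) \<partial>lborel)
        = (\<integral>\<^sup>+x. ?a (c * (y / c + x)) * ?b (- (c * (y / c + x)) + y) \<partial>lborel)"
      by (rule nn_integral_lborel_shift[symmetric]) measurable
    also have "\<dots> = (\<integral>\<^sup>+x. ?a (c * x + y) * ?b x \<partial>lborel)"
    proof -
      have "c * (y / c + x) = c * x + y" for x
        using c0 by (simp add: distrib_left)
      then show ?thesis
        using c by (simp add: indicator_def B_def norm_mult)
    qed
    finally show "(\<integral>\<^sup>+x. ?a (c * x) * ?b (- (c * x) + y) \<partial>lborel)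
        = (\<integral>\<^sup>+x. ?a (c * x + y) * ?b x \<partial>lborel)" .
  qed
  also have "\<dots> = (\<integral>\<^sup>+x. (\<integral>\<^sup>+y. ?a (c * x + y) * ?b x \<partial>lborel) \<partial>lborel)"
    by (rule lborel_pair.Fubini') measurable
  also have "\<dots> = emeasure lborel A * emeasure lborel B"
    by (simp add: nn_integral_multc nn_integral_lborel_shift nn_integral_cmult)
  finally show "emeasure (distr lborel borel ((*) c)) A = emeasure lborel A"
    by (simp add: B_def emeasure_ball unit_ball_vol_2 ennreal_mult_cancel_left mult.commute[of _ "ennreal pi"])
qed simp

lemma emeasure_disk: "r \<ge> 0 \<Longrightarrow> emeasure lborel (ball (z :: complex) r) = ennreal (pi * r\<^sup>2)"
  by (simp add: emeasure_ball unit_ball_vol_2)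

lemma sets_disk_area [simp, measurable_cong]: "sets disk_area = sets borel"
  by (simp add: disk_area_def)

lemma space_disk_area [simp]: "space disk_area = UNIV"
  by (simp add: disk_area_def)

interpretation disk: prob_space disk_area
  unfolding disk_area_def by (rule prob_space_uniform_measure) (auto simp: emeasure_disk)

lemma AE_disk_area: "AE z in disk_area. z \<in> unit_disk"
  unfolding disk_area_def by (rule AE_uniform_measureI) auto

lemma AE_disk_areaI: "(\<And>z. z \<in> unit_disk \<Longrightarrow> P z) \<Longrightarrow> AE z in disk_area. P z"
  using AE_disk_area by (rule AE_mp) auto

lemma distr_disk_area_rotation:
  assumes c: "cmod c = 1"
  shows "distr disk_area borel ((*) c) = disk_area"
proof (rule measure_eqI)
  fix A assume "A \<in> sets (distr disk_area borel ((*) c))"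
  then have A[measurable]: "A \<in> sets borel" by simp
  have eq: "unit_disk \<inter> (*) c -` A = (*) c -` (unit_disk \<inter> A)"
    using c by (auto simp: norm_mult)
  have M: "(*) c -` A \<in> sets borel"
    using measurable_sets[of "(*) c" borel borel A] by simp
  have "emeasure lborel (unit_disk \<inter> (*) c -` A) = emeasure (distr lborel borel ((*) c)) (unit_disk \<inter> A)"
    unfolding eq by (subst emeasure_distr) auto
  also have "\<dots> = emeasure lborel (unit_disk \<inter> A)"
    by (simp add: distr_lborel_mult_unimodular[OF c])
  finally show "emeasure (distr disk_area borel ((*) c)) A = emeasure disk_area A"
    using M by (subst emeasure_distr) (auto simp: disk_area_def)
qed simp

text \<open>The disk of radius \<open>r\<close> has normalized area \<open>r\<^sup>2\<close>, so the squared modulus is uniformly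
  distributed on the unit interval, and the integral becomes an elementary one.\<close>

lemma integral_cmod_power:
  "(\<integral>z. cmod z ^ (2 * n) \<partial>disk_area) = 1 / (real n + 1)"
proof -
  have *: "distributed disk_area lborel (\<lambda>z. (cmod z)\<^sup>2)
      (\<lambda>x. indicator {0..1} x / measure lborel {0..1::real})"
  proof (rule disk.uniform_distrI_borel_atLeastAtMost)
    fix t :: real assume t: "0 \<le> t" "t \<le> 1"
    have "(cmod z)\<^sup>2 \<le> t \<longleftrightarrow> cmod z \<le> sqrt t" for z
      using real_sqrt_le_iff[of "(cmod z)\<^sup>2" t] by simp
    then have eq: "{z::complex. (cmod z)\<^sup>2 \<le> t} = cball 0 (sqrt t)"
      by (simp only: set_eq_iff mem_Collect_eq mem_cball_0 simp_thms)
    have "measure disk_area (cball 0 (sqrt t)) = measure lborel (ball 0 1 \<inter> cball (0::complex) (sqrt t)) / pi"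
      unfolding disk_area_def by (subst measure_uniform_measure) (auto simp: emeasure_disk content_ball unit_ball_vol_2)
    moreover have "measure lborel (ball 0 1 \<inter> cball (0::complex) (sqrt t)) = pi * t"
    proof (cases "t = 1")
      case True
      then have "ball 0 1 \<inter> cball (0::complex) (sqrt t) = ball 0 1" by auto
      then show ?thesis using True by (simp add: content_ball unit_ball_vol_2)
    next
      case False
      then have "sqrt t < 1" using t by simp
      then have "cball (0::complex) (sqrt t) \<subseteq> ball 0 1"
        by (auto simp del: real_sqrt_lt_1_iff)
      then have "ball 0 1 \<inter> cball (0::complex) (sqrt t) = cball 0 (sqrt t)" by blast
      then show ?thesis using t by (simp add: content_cball unit_ball_vol_2)
    qed
    ultimately show "measure disk_area {z \<in> space disk_area. (cmod z)\<^sup>2 \<le> t} = (t - 0) / (1 - 0)"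
      by (simp add: eq)
  qed auto
  have "(\<integral>z. cmod z ^ (2 * n) \<partial>disk_area) = (\<integral>z. ((cmod z)\<^sup>2) ^ n \<partial>disk_area)"
    by (simp add: power_mult)
  also have "\<dots> = (\<integral>x. indicator {0..1} x / measure lborel {0..1::real} * x ^ n \<partial>lborel)"
    by (rule distributed_integral[OF *, symmetric]) auto
  also have "\<dots> = (\<integral>x. x ^ n * indicator {0..1::real} x \<partial>lborel)"
    by (intro Bochner_Integration.integral_cong) auto
  also have "\<dots> = 1 / (real n + 1)"
    by (subst integral_power) auto
  finally show ?thesis .
qed

section \<open>Mean values of holomorphic functions\<close>

lemma integral_uniform_measure:
  fixes f :: "'a \<Rightarrow> 'b :: {banach, second_countable_topology}"
  assumes A [measurable]: "A \<in> sets M" and fin: "emeasure M A \<noteq> \<infinity>" "emeasure M A \<noteq> 0"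
    and f [measurable]: "f \<in> borel_measurable M"
  shows "(\<integral>x. f x \<partial>uniform_measure M A) = (1 / measure M A) *\<^sub>R (LINT x:A|M. f x)"
proof -
  have pos: "measure M A > 0"
    using fin by (metis ennreal_0 emeasure_eq_ennreal_measure measure_nonneg less_eq_real_def infinity_ennreal_def)
  have eq: "uniform_measure M A = density M (\<lambda>x. ennreal (indicator A x / measure M A))"
    unfolding uniform_measure_def
    by (intro density_cong) (use fin pos in \<open>auto simp: emeasure_eq_ennreal_measure divide_ennreal split: split_indicator\<close>,
        metis divide_ennreal ennreal_1 zero_le_one)
  show ?thesis
    unfolding eq set_lebesgue_integral_def by (subst integral_density) (use pos in \<open>auto simp flip: integral_scaleR_right\<close>)
qed

definition circle_angle :: "real measure" where
  "circle_angle = uniform_measure lborel {0..2 * pi}"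

interpretation circle_angle: prob_space circle_angle
  unfolding circle_angle_def by (rule prob_space_uniform_measure) auto

lemma sets_circle_angle [simp, measurable_cong]: "sets circle_angle = sets borel"
  by (simp add: circle_angle_def)

text \<open>Cauchy's integral formula at the centre of the circle through \<open>z\<close>.\<close>

lemma circle_mean:
  assumes f: "f holomorphic_on unit_disk" and z: "z \<in> unit_disk"
  shows "(\<integral>t. f (cis t * z) \<partial>circle_angle) = f 0"
proof -
  \<comment> \<open>Rescaling by \<open>z\<close> makes the circle the unit circle, also when \<open>z = 0\<close>.\<close>
  define g where "g u = f (u * z)" for u
  have sub: "(\<lambda>u. u * z) ` cball 0 1 \<subseteq> unit_disk"
  proof (rule image_subsetI)
    fix u :: complex assume "u \<in> cball 0 1"
    then have "cmod u * cmod z \<le> 1 * cmod z"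
      by (intro mult_right_mono) auto
    then show "u * z \<in> unit_disk"
      using z by (simp add: norm_mult)
  qed
  have g: "g holomorphic_on cball 0 1"
    unfolding g_def
    by (rule holomorphic_on_compose_gen[OF _ f sub, unfolded o_def]) (intro holomorphic_intros)
  have cont: "continuous_on S (\<lambda>t. g (cis t))" for S
    by (intro continuous_on_compose2[OF holomorphic_on_imp_continuous_on[OF g]] continuous_intros) auto
  have "((\<lambda>u. g u / (u - 0)) has_contour_integral (2 * of_real pi * \<i> * g 0)) (circlepath 0 1)"
    by (rule Cauchy_integral_circlepath_simple) (use g in auto)
  then have "((\<lambda>t. g (0 + of_real 1 * cis t) / (0 + of_real 1 * cis t - 0) * of_real 1 * \<i> * cis t)
      has_integral (2 * of_real pi * \<i> * g 0)) {0..2 * pi}"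
    unfolding circlepath_def by (subst (asm) has_contour_integral_part_circlepath_iff) auto
  then have "((\<lambda>t. \<i> * g (cis t)) has_integral (\<i> * (2 * of_real pi * g 0))) {0..2 * pi}"
    by (simp add: mult_ac)
  then have "((\<lambda>t. - \<i> * (\<i> * g (cis t))) has_integral (- \<i> * (\<i> * (2 * of_real pi * g 0)))) {0..2 * pi}"
    by (rule has_integral_mult_right)
  then have "integral {0..2 * pi} (\<lambda>t. g (cis t)) = 2 * of_real pi * g 0"
    by (simp add: integral_unique flip: mult.assoc)
  moreover have "(LINT t:{0..2*pi}|lborel. g (cis t)) = integral {0..2 * pi} (\<lambda>t. g (cis t))"
    by (intro set_borel_integral_eq_integral borel_integrable_atLeastAtMost' cont)
  moreover have "(\<integral>t. f (cis t * z) \<partial>circle_angle) = (1 / (2 * pi)) *\<^sub>R (LINT t:{0..2*pi}|lborel. g (cis t))"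
    unfolding circle_angle_def g_def[symmetric]
    by (subst integral_uniform_measure) (auto intro!: borel_measurable_continuous_onI cont)
  ultimately show ?thesis
    by (simp add: scaleR_conv_of_real g_def)
qed

text \<open>A radial weight and the area measure are both unchanged by rotations. The integral may therefore
  be averaged over all rotations; after exchanging the two integrals the inner one is a circle
  mean, which Cauchy's formula evaluates. Integrability is asked of the product,
  because in the application to the difference quotient of a Bergman function it is the product
  that is visibly integrable.\<close>

lemma radial_mean_value:
  fixes s :: "real \<Rightarrow> complex"
  assumes k: "k holomorphic_on unit_disk" and [measurable]: "s \<in> borel_measurable borel"
    and int: "integrable disk_area (\<lambda>z. s (cmod z) * k z)"
  shows "(\<integral>z. s (cmod z) * k z \<partial>disk_area) = k 0 * (\<integral>z. s (cmod z) \<partial>disk_area)"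
proof -
  define K where "K z = (if z \<in> unit_disk then k z else 0)" for z
  have K [measurable]: "K \<in> borel_measurable borel"
    unfolding K_def by (rule borel_measurable_continuous_on_if) (use k holomorphic_on_imp_continuous_on in auto)
  define F where "F z = s (cmod z) * K z" for z
  have [measurable]: "F \<in> borel_measurable borel" unfolding F_def by measurable
  have F: "integrable disk_area F"
    using int by (rule integrable_cong_AE_imp) (auto simp: F_def K_def intro!: AE_disk_areaI)
  interpret pair_sigma_finite circle_angle disk_area ..
  have [measurable]: "cis \<in> borel_measurable borel"
    by (intro borel_measurable_continuous_onI continuous_intros)
  \<comment> \<open>Stated for every range type, since it is used for \<open>F\<close> and for its norm.\<close>
  have rot: "integrable disk_area (\<lambda>z. h (cis t * z)) \<and> (\<integral>z. h (cis t * z) \<partial>disk_area) = (\<integral>z. h z \<partial>disk_area)"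
    if h: "integrable disk_area h" for t and h :: "complex \<Rightarrow> 'b::{banach, second_countable_topology}"
  proof -
    have [measurable]: "h \<in> borel_measurable borel" using borel_measurable_integrable[OF h] by (simp cong: measurable_cong_sets)
    have "integrable (distr disk_area borel ((*) (cis t))) h"
      using h by (simp add: distr_disk_area_rotation)
    moreover have "(\<integral>z. h z \<partial>distr disk_area borel ((*) (cis t))) = (\<integral>z. h (cis t * z) \<partial>disk_area)"
      by (rule integral_distr) auto
    ultimately show ?thesis
      using integrable_distr[of "(*) (cis t)" disk_area borel h] by (simp add: distr_disk_area_rotation)
  qed
  have I: "integrable (circle_angle \<Otimes>\<^sub>M disk_area) (\<lambda>(t, z). F (cis t * z))"
  proof (rule Fubini_integrable)
    show "integrable circle_angle (\<lambda>t. \<integral>z. norm (case (t, z) of (t, z) \<Rightarrow> F (cis t * z)) \<partial>disk_area)"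
      using rot[OF integrable_norm[OF F]] by simp
    show "AE t in circle_angle. integrable disk_area (\<lambda>z. case (t, z) of (t, z) \<Rightarrow> F (cis t * z))"
      using rot[OF F] by simp
  qed measurable
  have "(\<integral>z. s (cmod z) * k z \<partial>disk_area) = (\<integral>z. F z \<partial>disk_area)"
    by (intro integral_cong_AE AE_disk_areaI borel_measurable_integrable[OF F]
        borel_measurable_integrable[OF int]) (simp add: F_def K_def)
  also have "\<dots> = (\<integral>t. (\<integral>z. F (cis t * z) \<partial>disk_area) \<partial>circle_angle)"
    using rot[OF F] by (simp add: circle_angle.prob_space)
  also have "\<dots> = (\<integral>z. (\<integral>t. F (cis t * z) \<partial>circle_angle) \<partial>disk_area)"
    by (rule Fubini_integral[symmetric, OF I])
  also have "\<dots> = (\<integral>z. k 0 * s (cmod z) \<partial>disk_area)"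
  proof (intro integral_cong_AE AE_disk_areaI)
    fix z :: complex assume z: "z \<in> unit_disk"
    have "(\<integral>t. F (cis t * z) \<partial>circle_angle) = (\<integral>t. s (cmod z) * k (cis t * z) \<partial>circle_angle)"
      using z by (intro Bochner_Integration.integral_cong) (auto simp: F_def K_def norm_mult)
    then show "(\<integral>t. F (cis t * z) \<partial>circle_angle) = k 0 * s (cmod z)"
      by (simp add: circle_mean[OF k z])
  qed measurable
  finally show ?thesis by simp
qed

section \<open>Square-integrable functions on the disk\<close>

definition sq_integrable :: "(complex \<Rightarrow> complex) \<Rightarrow> bool" where
  "sq_integrable f \<longleftrightarrow> f \<in> borel_measurable borel \<and> integrable disk_area (\<lambda>z. (cmod (f z))\<^sup>2)"

definition norm_sq :: "(complex \<Rightarrow> complex) \<Rightarrow> real" where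
  "norm_sq f = (\<integral>z. (cmod (f z))\<^sup>2 \<partial>disk_area)"

lemma norm_sq_nonneg: "norm_sq f \<ge> 0"
  by (simp add: norm_sq_def)

lemma parallelogram_complex: "(cmod (x + y))\<^sup>2 + (cmod (x - y))\<^sup>2 = 2 * (cmod x)\<^sup>2 + 2 * (cmod y)\<^sup>2"
  unfolding cmod_power2 by (simp add: power2_eq_square algebra_simps)

lemma borel_measurable_cnj [measurable (raw)]:
  "f \<in> borel_measurable M \<Longrightarrow> (\<lambda>x. cnj (f x)) \<in> borel_measurable M"
  by (rule borel_measurable_continuous_on[of cnj]) (intro continuous_intros)

lemma sq_integrable_add:
  assumes "sq_integrable f" "sq_integrable g"
  shows "sq_integrable (\<lambda>z. f z + g z)"
  unfolding sq_integrable_def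
proof
  show [measurable]: "(\<lambda>z. f z + g z) \<in> borel_measurable borel"
    using assms by (auto simp: sq_integrable_def)
  show "integrable disk_area (\<lambda>z. (cmod (f z + g z))\<^sup>2)"
  proof (rule Bochner_Integration.integrable_bound)
    show "integrable disk_area (\<lambda>z. 2 * (cmod (f z))\<^sup>2 + 2 * (cmod (g z))\<^sup>2)"
      using assms by (auto simp: sq_integrable_def)
    show "AE z in disk_area. norm ((cmod (f z + g z))\<^sup>2) \<le> norm (2 * (cmod (f z))\<^sup>2 + 2 * (cmod (g z))\<^sup>2)"
      by (rule AE_I2) (simp flip: parallelogram_complex)
  qed measurable
qed

lemma sq_integrable_mult_bounded:
  assumes "sq_integrable f" and [measurable]: "p \<in> borel_measurable borel"
    and C: "\<And>z. z \<in> unit_disk \<Longrightarrow> cmod (p z) \<le> C"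
  shows "sq_integrable (\<lambda>z. p z * f z)"
  unfolding sq_integrable_def
proof
  show [measurable]: "(\<lambda>z. p z * f z) \<in> borel_measurable borel"
    using assms by (auto simp: sq_integrable_def)
  show "integrable disk_area (\<lambda>z. (cmod (p z * f z))\<^sup>2)"
  proof (rule Bochner_Integration.integrable_bound)
    show "integrable disk_area (\<lambda>z. C\<^sup>2 * (cmod (f z))\<^sup>2)"
      using assms by (auto simp: sq_integrable_def)
    show "AE z in disk_area. norm ((cmod (p z * f z))\<^sup>2) \<le> norm (C\<^sup>2 * (cmod (f z))\<^sup>2)"
      by (rule AE_disk_areaI) (auto simp: norm_mult power_mult_distrib intro!: mult_right_mono power_mono C)
  qed measurable
qed

lemma sq_integrable_cmult: "sq_integrable f \<Longrightarrow> sq_integrable (\<lambda>z. c * f z)"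
  by (rule sq_integrable_mult_bounded) auto

lemma sq_integrable_diff:
  assumes "sq_integrable f" "sq_integrable g"
  shows "sq_integrable (\<lambda>z. f z - g z)"
  using sq_integrable_add[OF assms(1) sq_integrable_cmult[OF assms(2), of "-1"]] by simp

lemma integrable_ip:
  assumes "sq_integrable f" "sq_integrable g"
  shows "integrable disk_area (\<lambda>z. f z * cnj (g z))"
proof (rule Bochner_Integration.integrable_bound)
  have [measurable]: "f \<in> borel_measurable borel" "g \<in> borel_measurable borel"
    using assms by (auto simp: sq_integrable_def)
  show "(\<lambda>z. f z * cnj (g z)) \<in> borel_measurable disk_area" by measurable
  show "integrable disk_area (\<lambda>z. (cmod (f z))\<^sup>2 + (cmod (g z))\<^sup>2)"
    using assms by (auto simp: sq_integrable_def)
  have "x * y \<le> x\<^sup>2 + y\<^sup>2" if "x \<ge> 0" "y \<ge> 0" for x y :: real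
    using that sum_squares_bound[of x y] mult_nonneg_nonneg[of x y] by linarith
  then show "AE z in disk_area. norm (f z * cnj (g z)) \<le> norm ((cmod (f z))\<^sup>2 + (cmod (g z))\<^sup>2)"
    by (intro AE_I2) (simp add: norm_mult)
qed

lemma ip_add_left:
  "sq_integrable f \<Longrightarrow> sq_integrable g \<Longrightarrow> sq_integrable h \<Longrightarrow> ip (\<lambda>z. f z + g z) h = ip f h + ip g h"
  unfolding ip_def by (simp add: distrib_right integrable_ip)

lemma ip_diff_left:
  "sq_integrable f \<Longrightarrow> sq_integrable g \<Longrightarrow> sq_integrable h \<Longrightarrow> ip (\<lambda>z. f z - g z) h = ip f h - ip g h"
  unfolding ip_def by (simp add: left_diff_distrib integrable_ip)

lemma ip_cmult_left: "ip (\<lambda>z. c * f z) h = c * ip f h"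
  unfolding ip_def by (simp add: mult.assoc)

lemma ip_commute: "ip g f = cnj (ip f g)"
  unfolding ip_def Bochner_Integration.integral_cnj[symmetric] by (simp add: mult.commute)

lemma ip_self: "ip f f = of_real (norm_sq f)"
  unfolding ip_def norm_sq_def by (simp add: complex_norm_square[symmetric] flip: integral_complex_of_real)

lemma ip_cong: "(\<And>z. z \<in> unit_disk \<Longrightarrow> f z = f' z) \<Longrightarrow> (\<And>z. z \<in> unit_disk \<Longrightarrow> g z = g' z) \<Longrightarrow>
    sq_integrable f \<Longrightarrow> sq_integrable f' \<Longrightarrow> sq_integrable g \<Longrightarrow> sq_integrable g' \<Longrightarrow> ip f g = ip f' g'"
  unfolding ip_def by (intro integral_cong_AE AE_disk_areaI) (auto simp: sq_integrable_def)

lemma norm_sq_add: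
  assumes "sq_integrable f" "sq_integrable g"
  shows "norm_sq (\<lambda>z. f z + g z) = norm_sq f + 2 * Re (ip f g) + norm_sq g"
proof -
  define h where "h = (\<lambda>z. f z * cnj (g z))"
  have h: "integrable disk_area h"
    unfolding h_def by (rule integrable_ip[OF assms])
  have "norm_sq (\<lambda>z. f z + g z) = (\<integral>z. (cmod (f z))\<^sup>2 + 2 * Re (h z) + (cmod (g z))\<^sup>2 \<partial>disk_area)"
    unfolding norm_sq_def cmod_power2 h_def
    by (intro Bochner_Integration.integral_cong refl) (simp add: power2_eq_square algebra_simps)
  also have "\<dots> = norm_sq f + 2 * Re (integral\<^sup>L disk_area h) + norm_sq g"
    using assms h by (simp add: sq_integrable_def norm_sq_def)
  finally show ?thesis by (simp only: ip_def h_def)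
qed

section \<open>The Bergman space and its point evaluations\<close>

lemma bergman_measurable: 
  assumes f: "f \<in> bergman_space" shows "f \<in> borel_measurable borel"
proof -
  have "(\<lambda>z. if z \<in> unit_disk then f z else 0) \<in> borel_measurable borel"
    by (rule borel_measurable_continuous_on_if)
       (use f in \<open>auto simp: bergman_space_def intro: holomorphic_on_imp_continuous_on\<close>)
  also have "(\<lambda>z. if z \<in> unit_disk then f z else 0) = f"
    using f by (auto simp: bergman_space_def fun_eq_iff)
  finally show ?thesis .
qed

lemma bergman_space_iff:
  "f \<in> bergman_space \<longleftrightarrow> f holomorphic_on unit_disk \<and> (\<forall>z. z \<notin> unit_disk \<longrightarrow> f z = 0) \<and> sq_integrable f"
  using bergman_measurable[of f] by (auto simp: bergman_space_def sq_integrable_def)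

lemma bergman_sq_integrable: "f \<in> bergman_space \<Longrightarrow> sq_integrable f"
  by (simp add: bergman_space_iff)

lemma bergman_add: "f \<in> bergman_space \<Longrightarrow> g \<in> bergman_space \<Longrightarrow> (\<lambda>z. f z + g z) \<in> bergman_space"
  by (auto simp: bergman_space_iff sq_integrable_add intro: holomorphic_intros)

lemma bergman_diff: "f \<in> bergman_space \<Longrightarrow> g \<in> bergman_space \<Longrightarrow> (\<lambda>z. f z - g z) \<in> bergman_space"
  by (auto simp: bergman_space_iff sq_integrable_diff intro: holomorphic_intros)

lemma bergman_cmult: "f \<in> bergman_space \<Longrightarrow> (\<lambda>z. c * f z) \<in> bergman_space"
  by (auto simp: bergman_space_iff sq_integrable_cmult intro: holomorphic_intros)

lemma bergman_zero: "(\<lambda>z. 0) \<in> bergman_space"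
  by (simp add: bergman_space_def)

text \<open>Point evaluations are bounded. The square of a holomorphic function is holomorphic, so its mean
  over a disk about \<open>z0\<close> is its value there, and the modulus of this mean is at most the integral
  of the squared modulus. The largest disk about \<open>z0\<close> inside the unit disk is the affine image of the
  unit disk with ratio \<open>1 - cmod z0\<close>, and the change of variables produces the denominator.\<close>

lemma bergman_point_evaluation:
  assumes f: "f \<in> bergman_space" and z0: "cmod z0 < 1"
  shows "(cmod (f z0))\<^sup>2 \<le> norm_sq f / (1 - cmod z0)\<^sup>2"
proof -
  define R where "R = 1 - cmod z0"
  have R: "R > 0" using z0 by (simp add: R_def)
  define g where "g w = f (z0 + R *\<^sub>R w)" for w
  note [measurable] = bergman_measurable[OF f]
  have [measurable]: "g \<in> borel_measurable borel" unfolding g_def by measurable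
  have sub: "z0 + R *\<^sub>R w \<in> unit_disk" if "w \<in> unit_disk" for w
  proof -
    have "cmod (z0 + R *\<^sub>R w) \<le> cmod z0 + R * cmod w"
      using norm_triangle_ineq[of z0 "R *\<^sub>R w"] R by simp
    also have "\<dots> < cmod z0 + R * 1"
      using that R by (intro add_strict_left_mono mult_strict_left_mono) auto
    finally show ?thesis by (simp add: R_def)
  qed
  have "g holomorphic_on unit_disk"
    unfolding g_def
  proof (rule holomorphic_on_compose_gen[of _ unit_disk f unit_disk, unfolded o_def])
    show "(\<lambda>w. z0 + R *\<^sub>R w) holomorphic_on unit_disk"
      unfolding scaleR_conv_of_real by (intro holomorphic_intros)
  qed (use f sub in \<open>auto simp: bergman_space_def\<close>)
  then have hol: "(\<lambda>w. (g w)\<^sup>2) holomorphic_on unit_disk"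
    by (rule holomorphic_on_power)
  have int_f: "(\<integral>\<^sup>+z. ennreal ((cmod (f z))\<^sup>2) \<partial>disk_area) = ennreal (norm_sq f)"
    unfolding norm_sq_def using f by (intro nn_integral_eq_integral) (auto simp: bergman_space_def)
  let ?Ig = "\<integral>\<^sup>+w. ennreal ((cmod (g w))\<^sup>2) \<partial>disk_area"
  have "ennreal (R\<^sup>2) * ?Ig
      = ennreal (R\<^sup>2) * (\<integral>\<^sup>+w. ennreal ((cmod (g w))\<^sup>2) * indicator unit_disk w \<partial>lborel) / ennreal pi"
    unfolding disk_area_def
    by (subst nn_integral_uniform_measure) (auto simp: emeasure_disk ennreal_times_divide)
  also have "\<dots> \<le> ennreal (R\<^sup>2) * (\<integral>\<^sup>+w. ennreal ((cmod (g w))\<^sup>2) \<partial>lborel) / ennreal pi"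
    by (intro divide_right_mono_ennreal mult_left_mono nn_integral_mono) (auto split: split_indicator)
  also have "ennreal (R\<^sup>2) * (\<integral>\<^sup>+w. ennreal ((cmod (g w))\<^sup>2) \<partial>lborel)
      = (\<integral>\<^sup>+z. ennreal ((cmod (f z))\<^sup>2) \<partial>lborel)"
    by (subst (2) lborel_affine[of R z0])
       (use R in \<open>auto simp: nn_integral_density nn_integral_distr nn_integral_cmult g_def\<close>)
  also have "\<dots> = (\<integral>\<^sup>+z. ennreal ((cmod (f z))\<^sup>2) * indicator unit_disk z \<partial>lborel)"
    using f by (intro nn_integral_cong) (auto simp: bergman_space_def split: split_indicator)
  also have "\<dots> / ennreal pi = (\<integral>\<^sup>+z. ennreal ((cmod (f z))\<^sup>2) \<partial>disk_area)"
    unfolding disk_area_def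
    by (subst nn_integral_uniform_measure) (auto simp: emeasure_disk)
  \<comment> \<open>The computation is in extended reals because square-integrability of \<open>g\<close> is a consequence of it.\<close>
  finally have le: "ennreal (R\<^sup>2) * ?Ig \<le> ennreal (norm_sq f)"
    by (simp add: int_f)
  have "?Ig < \<infinity>"
  proof (rule ccontr)
    assume "\<not> ?Ig < \<infinity>"
    then have "?Ig = top" by (simp only: infinity_ennreal_def not_less top_unique)
    then have "ennreal (R\<^sup>2) * ?Ig = top"
      using R by (simp add: ennreal_mult_eq_top_iff)
    with le show False by (simp add: top_unique)
  qed
  then have int_g: "integrable disk_area (\<lambda>w. (cmod (g w))\<^sup>2)"
    by (intro integrableI_nonneg) auto
  then have "?Ig = ennreal (norm_sq g)"
    unfolding norm_sq_def by (intro nn_integral_eq_integral) auto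
  with le have le': "R\<^sup>2 * norm_sq g \<le> norm_sq f"
    by (simp add: norm_sq_nonneg flip: ennreal_mult)
  have "integrable disk_area (\<lambda>w. (g w)\<^sup>2)"
    by (subst integrable_norm_iff[symmetric]) (use int_g in \<open>auto simp: norm_power\<close>)
  then have "(\<integral>w. (g w)\<^sup>2 \<partial>disk_area) = (g 0)\<^sup>2"
    using radial_mean_value[OF hol, of "\<lambda>_. 1"] disk.prob_space by simp
  then have "(cmod (f z0))\<^sup>2 = cmod (\<integral>w. (g w)\<^sup>2 \<partial>disk_area)"
    by (simp add: g_def norm_power)
  also have "\<dots> \<le> norm_sq g"
    unfolding norm_sq_def
    using integral_norm_bound[of disk_area "\<lambda>w. (g w)\<^sup>2"] by (simp add: norm_power)
  also have "\<dots> \<le> norm_sq f / R\<^sup>2"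
    using le' R by (simp add: field_simps)
  finally show ?thesis by (simp add: R_def)
qed

section \<open>Orthogonal projection onto the Bergman space\<close>

lemma norm_sq_cmult: "norm_sq (\<lambda>z. c * f z) = (cmod c)\<^sup>2 * norm_sq f"
  by (simp add: norm_sq_def norm_mult power_mult_distrib)

lemma norm_sq_parallelogram:
  assumes "sq_integrable f" "sq_integrable g"
  shows "norm_sq (\<lambda>z. f z + g z) + norm_sq (\<lambda>z. f z - g z) = 2 * norm_sq f + 2 * norm_sq g"
proof -
  have "norm_sq (\<lambda>z. f z + g z) + norm_sq (\<lambda>z. f z - g z)
      = (\<integral>z. (cmod (f z + g z))\<^sup>2 + (cmod (f z - g z))\<^sup>2 \<partial>disk_area)"
    using sq_integrable_add[OF assms] sq_integrable_diff[OF assms]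
    unfolding norm_sq_def sq_integrable_def by (intro Bochner_Integration.integral_add[symmetric]) blast+
  also have "\<dots> = (\<integral>z. 2 * (cmod (f z))\<^sup>2 + 2 * (cmod (g z))\<^sup>2 \<partial>disk_area)"
    by (simp only: parallelogram_complex)
  also have "\<dots> = 2 * norm_sq f + 2 * norm_sq g"
    using assms by (simp add: sq_integrable_def norm_sq_def)
  finally show ?thesis .
qed

text \<open>A minimizing sequence is Cauchy in norm by the parallelogram law. Bounded point evaluations turn
  this into uniform convergence on smaller disks, so the limit is holomorphic. Fatou's lemma shows
  that this pointwise limit attains the infimum.\<close>

lemma bergman_nearest_point:
  assumes F: "sq_integrable F"
  shows "\<exists>g\<in>bergman_space. \<forall>h\<in>bergman_space. norm_sq (\<lambda>z. F z - g z) \<le> norm_sq (\<lambda>z. F z - h z)"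
proof -
  define N where "N g = norm_sq (\<lambda>z. F z - g z)" for g
  define d where "d = Inf (N ` bergman_space)"
  have bdd: "bdd_below (N ` bergman_space)"
    by (rule bdd_belowI[of _ 0]) (auto simp: N_def norm_sq_nonneg)
  have d_le: "d \<le> N g" if "g \<in> bergman_space" for g
    unfolding d_def using bdd that by (intro cInf_lower) auto
  have "\<exists>g\<in>bergman_space. N g < d + 1 / real (Suc n)" for n
    using cInf_lessD[of "N ` bergman_space" "d + 1 / real (Suc n)"] bergman_zero
    by (auto simp: d_def)
  then obtain G where G: "\<And>n. G n \<in> bergman_space" "\<And>n. N (G n) < d + 1 / real (Suc n)"
    by metis
  have close: "norm_sq (\<lambda>z. G n z - G k z) \<le> 2 / real (Suc n) + 2 / real (Suc k)" for n k
  proof -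
    \<comment> \<open>The midpoint lies in the space, so its distance to \<open>F\<close> is at least the infimum.\<close>
    let ?m = "\<lambda>z. 1/2 * (G n z + G k z)"
    have m: "?m \<in> bergman_space"
      by (intro bergman_cmult bergman_add G)
    have "norm_sq (\<lambda>z. (F z - G n z) + (F z - G k z)) + norm_sq (\<lambda>z. (F z - G n z) - (F z - G k z))
        = 2 * N (G n) + 2 * N (G k)"
      unfolding N_def by (rule norm_sq_parallelogram) (intro sq_integrable_diff F bergman_sq_integrable G)+
    moreover have "norm_sq (\<lambda>z. (F z - G n z) + (F z - G k z)) = 4 * N ?m"
    proof -
      have "(\<lambda>z. (F z - G n z) + (F z - G k z)) = (\<lambda>z. 2 * (F z - ?m z))"
        by (auto simp: fun_eq_iff algebra_simps)
      then show ?thesis by (simp only: norm_sq_cmult N_def) simp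
    qed
    moreover have "norm_sq (\<lambda>z. (F z - G n z) - (F z - G k z)) = norm_sq (\<lambda>z. G n z - G k z)"
      by (simp add: norm_sq_def norm_minus_commute)
    ultimately show ?thesis
      using d_le[OF m] G(2)[of n] G(2)[of k] by simp
  qed
  define g where "g z = (if z \<in> unit_disk then lim (\<lambda>n. G n z) else 0)" for z :: complex
  have ulim: "uniform_limit (cball 0 r) G g sequentially" if r: "r < 1" for r
  proof -
    have "uniformly_Cauchy_on (cball 0 r) G"
    proof (rule uniformly_Cauchy_onI)
      fix e :: real assume e: "e > 0"
      \<comment> \<open>Point evaluation at radius \<open>r\<close> costs a factor \<open>1 / (1 - r)\<close>, so norms have to be below \<open>\<delta>\<close>.\<close>
      define \<delta> where "\<delta> = e * (1 - r)"
      have \<delta>: "\<delta> > 0" using e r by (simp add: \<delta>_def)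
      obtain M where M: "4 / \<delta>\<^sup>2 < real M"
        using reals_Archimedean2 by blast
      show "\<exists>M. \<forall>z\<in>cball 0 r. \<forall>m\<ge>M. \<forall>n\<ge>M. dist (G m z) (G n z) < e"
      proof (intro exI ballI allI impI)
        fix z :: complex and n k assume z: "z \<in> cball 0 r" and nk: "n \<ge> M" "k \<ge> M"
        have "M > 0" using M \<delta> by (cases M) (auto simp: field_simps)
        have z1: "cmod z < 1" "1 - r \<le> 1 - cmod z" using z r by auto
        have "(cmod (G n z - G k z))\<^sup>2 \<le> norm_sq (\<lambda>z. G n z - G k z) / (1 - cmod z)\<^sup>2"
          using bergman_point_evaluation[OF bergman_diff[OF G(1)[of n] G(1)[of k]] z1(1)] .
        also have "\<dots> \<le> norm_sq (\<lambda>z. G n z - G k z) / (1 - r)\<^sup>2"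
          using z1 r by (intro divide_left_mono power_mono norm_sq_nonneg mult_pos_pos) auto
        also have "\<dots> \<le> (4 / real M) / (1 - r)\<^sup>2"
        proof (rule divide_right_mono)
          have "2 / real (Suc n) \<le> 2 / real M" "2 / real (Suc k) \<le> 2 / real M"
            using nk \<open>M > 0\<close> by (auto intro!: divide_left_mono)
          then show "norm_sq (\<lambda>z. G n z - G k z) \<le> 4 / real M"
            using close[of n k] by linarith
        qed simp
        also have "\<dots> < \<delta>\<^sup>2 / (1 - r)\<^sup>2"
          using M \<delta> r \<open>M > 0\<close> by (intro divide_strict_right_mono) (auto simp: field_simps)
        also have "\<dots> = e\<^sup>2"
          using r by (simp add: \<delta>_def power_mult_distrib)
        finally show "dist (G n z) (G k z) < e"
          using e by (simp add: dist_norm power2_less_imp_less)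
      qed
    qed
    then have "uniform_limit (cball 0 r) G (\<lambda>z. lim (\<lambda>n. G n z)) sequentially"
      using Cauchy_uniformly_convergent uniformly_convergent_uniform_limit_iff by blast
    then show ?thesis
      by (rule uniform_limit_cong'[THEN iffD1, rotated 2]) (use r in \<open>auto simp: g_def\<close>)
  qed
  have holo: "g holomorphic_on unit_disk"
  proof (rule holomorphic_uniform_sequence)
    show "G n holomorphic_on unit_disk" for n
      using G(1) by (simp add: bergman_space_def)
    fix z :: complex assume z: "z \<in> unit_disk"
    define \<delta> where "\<delta> = (1 - cmod z) / 2"
    have "0 < \<delta>" "cmod z + \<delta> < 1" using z by (auto simp: \<delta>_def field_simps)
    moreover have "cball z \<delta> \<subseteq> cball 0 (cmod z + \<delta>)"
      by (auto simp: dist_norm) (metis add.commute norm_minus_commute norm_triangle_le_diff norm_triangle_sub order_trans add_left_mono)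
    moreover have "cball 0 (cmod z + \<delta>) \<subseteq> unit_disk"
      using \<open>cmod z + \<delta> < 1\<close> by auto
    ultimately show "\<exists>d>0. cball z d \<subseteq> unit_disk \<and> uniform_limit (cball z d) G g sequentially"
      using uniform_limit_on_subset[OF ulim] by (meson order_trans)
  qed auto
  have lim: "(\<lambda>n. G n z) \<longlonglongrightarrow> g z" if "z \<in> unit_disk" for z
    using tendsto_uniform_limitI[OF ulim[of "cmod z"], of z] that by simp
  have meas [measurable]: "G n \<in> borel_measurable borel" "F \<in> borel_measurable borel" for n
    using bergman_measurable[OF G(1)] F by (auto simp: sq_integrable_def)
  have [measurable]: "g \<in> borel_measurable borel"
    unfolding g_def mem_ball_0 by measurable
  have "(\<integral>\<^sup>+z. ennreal ((cmod (F z - g z))\<^sup>2) \<partial>disk_area)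
      = (\<integral>\<^sup>+z. liminf (\<lambda>n. ennreal ((cmod (F z - G n z))\<^sup>2)) \<partial>disk_area)"
    by (intro nn_integral_cong_AE AE_disk_areaI lim_imp_Liminf[symmetric] tendsto_intros lim) auto
  also have "\<dots> \<le> liminf (\<lambda>n. \<integral>\<^sup>+z. ennreal ((cmod (F z - G n z))\<^sup>2) \<partial>disk_area)"
    by (rule nn_integral_liminf) measurable
  also have "(\<lambda>n. \<integral>\<^sup>+z. ennreal ((cmod (F z - G n z))\<^sup>2) \<partial>disk_area) = (\<lambda>n. ennreal (N (G n)))"
    unfolding N_def norm_sq_def
    by (intro ext nn_integral_eq_integral)
       (use sq_integrable_diff[OF F bergman_sq_integrable[OF G(1)]] in \<open>auto simp: sq_integrable_def\<close>)
  also have "liminf (\<lambda>n. ennreal (N (G n))) \<le> liminf (\<lambda>n. ennreal (d + 1 / real (Suc n)))"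
    by (intro Liminf_mono always_eventually allI ennreal_leI less_imp_le G)
  also have "liminf (\<lambda>n. ennreal (d + 1 / real (Suc n))) = ennreal d"
  proof (intro lim_imp_Liminf tendsto_ennrealI)
    have "(\<lambda>n. d + 1 / real (Suc n)) \<longlonglongrightarrow> d + 0"
      by (intro tendsto_intros LIMSEQ_Suc[OF lim_1_over_n])
    then show "(\<lambda>n. d + 1 / real (Suc n)) \<longlonglongrightarrow> d" by simp
  qed auto
  finally have le: "(\<integral>\<^sup>+z. ennreal ((cmod (F z - g z))\<^sup>2) \<partial>disk_area) \<le> ennreal d" .
  have "integrable disk_area (\<lambda>z. (cmod (F z - g z))\<^sup>2)"
    using le by (intro integrableI_nonneg) (auto intro: le_less_trans)
  then have diff: "sq_integrable (\<lambda>z. F z - g z)"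
    by (simp add: sq_integrable_def)
  then have "sq_integrable g"
    using sq_integrable_diff[OF F diff] by simp
  then have g: "g \<in> bergman_space"
    using holo by (auto simp: bergman_space_iff g_def)
  have "(\<integral>\<^sup>+z. ennreal ((cmod (F z - g z))\<^sup>2) \<partial>disk_area) = ennreal (N g)"
    using diff unfolding N_def norm_sq_def
    by (intro nn_integral_eq_integral) (auto simp: sq_integrable_def)
  moreover have "d \<ge> 0"
    unfolding d_def using bergman_zero by (intro cInf_greatest) (auto simp: N_def norm_sq_nonneg)
  ultimately have "N g \<le> d"
    using le by simp
  then show ?thesis
    using g d_le by (force simp: N_def)
qed

text \<open>If the inner product \<open>p\<close> were nonzero, moving \<open>g\<close> by a small multiple of \<open>p\<close> times \<open>h\<close> would
  decrease the distance: the gain is linear and the loss quadratic in the size of the step.\<close>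

lemma nearest_point_orthogonal:
  assumes F: "sq_integrable F" and g: "g \<in> bergman_space" and h: "h \<in> bergman_space"
    and near: "\<And>h. h \<in> bergman_space \<Longrightarrow> norm_sq (\<lambda>z. F z - g z) \<le> norm_sq (\<lambda>z. F z - h z)"
  shows "ip (\<lambda>z. F z - g z) h = 0"
proof (rule ccontr)
  define p where "p = ip (\<lambda>z. F z - g z) h"
  assume "ip (\<lambda>z. F z - g z) h \<noteq> 0"
  then have p: "(cmod p)\<^sup>2 > 0" by (simp add: p_def)
  have sq: "sq_integrable (\<lambda>z. F z - g z)" "sq_integrable h"
    using F g h by (auto intro: sq_integrable_diff bergman_sq_integrable)
  \<comment> \<open>The step is \<open>t * p\<close>. In units of \<open>(cmod p)\<^sup>2\<close> the linear gain is \<open>2 * t\<close> and the quadratic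
    loss \<open>t\<^sup>2 * norm_sq h\<close>, which this \<open>t\<close> keeps to at most half of the gain.\<close>
  define t where "t = 1 / (norm_sq h + 1)"
  have t: "t > 0" "t * norm_sq h \<le> 1" using norm_sq_nonneg[of h] by (auto simp: t_def field_simps)
  define s where "s = - (of_real t * p)"
  have "norm_sq (\<lambda>z. F z - g z) \<le> norm_sq (\<lambda>z. F z - (g z + (- s) * h z))"
    by (intro near bergman_add g bergman_cmult h)
  also have "(\<lambda>z. F z - (g z + (- s) * h z)) = (\<lambda>z. (F z - g z) + s * h z)"
    by (simp add: fun_eq_iff)
  also have "norm_sq \<dots> = norm_sq (\<lambda>z. F z - g z) + 2 * Re (ip (\<lambda>z. F z - g z) (\<lambda>z. s * h z)) + norm_sq (\<lambda>z. s * h z)"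
    by (intro norm_sq_add sq sq_integrable_cmult)
  also have "ip (\<lambda>z. F z - g z) (\<lambda>z. s * h z) = cnj s * p"
    unfolding p_def by (subst (1 2) ip_commute) (simp add: ip_cmult_left)
  also have "Re (cnj s * p) = - t * (cmod p)\<^sup>2"
    unfolding cmod_power2 by (simp add: s_def power2_eq_square algebra_simps)
  also have "norm_sq (\<lambda>z. s * h z) = t * (t * norm_sq h) * (cmod p)\<^sup>2"
    unfolding norm_sq_cmult using t by (simp add: s_def norm_mult power2_eq_square)
  finally have "2 * (t * (cmod p)\<^sup>2) \<le> t * (t * norm_sq h) * (cmod p)\<^sup>2"
    by simp
  also have "\<dots> \<le> t * 1 * (cmod p)\<^sup>2"
    using t by (intro mult_right_mono mult_left_mono) auto
  finally show False
    using t p by simp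
qed

lemma bergman_norm_sq_eq_0:
  assumes f: "f \<in> bergman_space" and 0: "norm_sq f = 0"
  shows "f = (\<lambda>z. 0)"
proof
  fix z show "f z = 0"
  proof (cases "cmod z < 1")
    case True
    then show ?thesis
      using bergman_point_evaluation[OF f True] by (simp only: 0) simp
  next
    case False
    then show ?thesis
      using f unfolding bergman_space_def mem_ball_0 by blast
  qed
qed

lemma bergman_orthogonal_unique:
  assumes g: "g \<in> bergman_space" and g': "g' \<in> bergman_space" and F: "sq_integrable F"
    and orth: "\<And>h. h \<in> bergman_space \<Longrightarrow> ip (\<lambda>z. F z - g z) h = 0"
    and orth': "\<And>h. h \<in> bergman_space \<Longrightarrow> ip (\<lambda>z. F z - g' z) h = 0"
  shows "g = g'"
proof -
  define h where "h = (\<lambda>z. g z - g' z)"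
  have h: "h \<in> bergman_space" unfolding h_def by (intro bergman_diff g g')
  have "h = (\<lambda>z. (F z - g' z) - (F z - g z))" by (simp add: h_def fun_eq_iff)
  then have "ip h h = ip (\<lambda>z. (F z - g' z) - (F z - g z)) h" by simp
  also have "\<dots> = ip (\<lambda>z. F z - g' z) h - ip (\<lambda>z. F z - g z) h"
    by (intro ip_diff_left sq_integrable_diff F bergman_sq_integrable g g' h)
  also have "\<dots> = 0"
    by (simp only: orth[OF h] orth'[OF h] diff_self)
  finally have "h = (\<lambda>z. 0)"
    using bergman_norm_sq_eq_0[OF h] by (simp add: ip_self)
  then show ?thesis
    by (simp add: h_def fun_eq_iff)
qed

text \<open>The nearest point has an orthogonal difference to \<open>F\<close>, and two such points differ by an element
  of the space that is orthogonal to itself. So the definite description in \<^const>\<open>bergman_proj\<close> picks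
  out an existing object.\<close>

lemma bergman_proj:
  assumes F: "sq_integrable F"
  shows bergman_proj_in: "bergman_proj F \<in> bergman_space"
    and bergman_proj_ip: "h \<in> bergman_space \<Longrightarrow> ip (bergman_proj F) h = ip F h"
proof -
  have "\<exists>!g. g \<in> bergman_space \<and> (\<forall>h\<in>bergman_space. ip (\<lambda>z. F z - g z) h = 0)"
  proof (rule ex_ex1I)
    show "\<exists>g. g \<in> bergman_space \<and> (\<forall>h\<in>bergman_space. ip (\<lambda>z. F z - g z) h = 0)"
    proof -
      obtain g where "g \<in> bergman_space"
        "\<And>h. h \<in> bergman_space \<Longrightarrow> norm_sq (\<lambda>z. F z - g z) \<le> norm_sq (\<lambda>z. F z - h z)"
        using bergman_nearest_point[OF F] by blast
      then show ?thesis
        using nearest_point_orthogonal[OF F] by blast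
    qed
  next
    fix g g'
    assume "g \<in> bergman_space \<and> (\<forall>h\<in>bergman_space. ip (\<lambda>z. F z - g z) h = 0)"
      and "g' \<in> bergman_space \<and> (\<forall>h\<in>bergman_space. ip (\<lambda>z. F z - g' z) h = 0)"
    then show "g = g'"
      by (intro bergman_orthogonal_unique[OF _ _ F]) auto
  qed
  from theI'[OF this] have *: "bergman_proj F \<in> bergman_space"
    "\<And>h. h \<in> bergman_space \<Longrightarrow> ip (\<lambda>z. F z - bergman_proj F z) h = 0"
    unfolding bergman_proj_def by auto
  show "bergman_proj F \<in> bergman_space" by fact
  show "ip (bergman_proj F) h = ip F h" if h: "h \<in> bergman_space"
    using *(2)[OF h] ip_diff_left[OF F bergman_sq_integrable[OF *(1)] bergman_sq_integrable[OF h]] by simp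
qed

lemma bergman_proj_eqI:
  assumes F: "sq_integrable F" and g: "g \<in> bergman_space"
    and eq: "\<And>h. h \<in> bergman_space \<Longrightarrow> ip F h = ip g h"
  shows "bergman_proj F = g"
proof (rule bergman_orthogonal_unique[OF bergman_proj_in[OF F] g F])
  fix h assume h: "h \<in> bergman_space"
  note diff = ip_diff_left[OF F bergman_sq_integrable bergman_sq_integrable[OF h]]
  show "ip (\<lambda>z. F z - bergman_proj F z) h = 0"
    by (simp only: diff[OF bergman_proj_in[OF F]] bergman_proj_ip[OF F h] diff_self)
  show "ip (\<lambda>z. F z - g z) h = 0"
    by (simp only: diff[OF g] eq[OF h] diff_self)
qed

section \<open>Toeplitz operators with bounded symbol\<close>

definition bounded_symbol :: "(complex \<Rightarrow> complex) \<Rightarrow> bool" where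
  "bounded_symbol p \<longleftrightarrow> p \<in> borel_measurable borel \<and> (\<exists>C. \<forall>z\<in>unit_disk. cmod (p z) \<le> C)"

lemma bounded_symbol_cnj: "bounded_symbol p \<Longrightarrow> bounded_symbol (\<lambda>z. cnj (p z))"
  by (auto simp: bounded_symbol_def)

lemma sq_integrable_symbol_mult: "bounded_symbol p \<Longrightarrow> sq_integrable f \<Longrightarrow> sq_integrable (\<lambda>z. p z * f z)"
  unfolding bounded_symbol_def using sq_integrable_mult_bounded by blast

lemma ip_mult_left: "ip (\<lambda>z. p z * f z) g = ip f (\<lambda>z. cnj (p z) * g z)"
  by (simp add: ip_def mult_ac)

lemma toeplitz_in:
  "bounded_symbol p \<Longrightarrow> f \<in> bergman_space \<Longrightarrow> toeplitz p f \<in> bergman_space"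
  unfolding toeplitz_def by (intro bergman_proj_in sq_integrable_symbol_mult bergman_sq_integrable)

lemma toeplitz_ip:
  "bounded_symbol p \<Longrightarrow> f \<in> bergman_space \<Longrightarrow> g \<in> bergman_space \<Longrightarrow>
    ip (toeplitz p f) g = ip (\<lambda>z. p z * f z) g"
  unfolding toeplitz_def by (intro bergman_proj_ip sq_integrable_symbol_mult bergman_sq_integrable)

text \<open>Moving the symbol to the other side of the inner product conjugates it, so the adjoint is the
  Toeplitz operator with conjugate symbol. Since \<^const>\<open>adj\<close> is a definite description over all of
  the Bergman space, this uses the projection of \<open>p * f\<close> for every \<open>f\<close>, not only for polynomials.\<close>

lemma adj_toeplitz:
  assumes p: "bounded_symbol p" and g: "g \<in> bergman_space"
  shows "adj (toeplitz p) g = toeplitz (\<lambda>z. cnj (p z)) g"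
proof -
  note p' = bounded_symbol_cnj[OF p]
  show ?thesis
    unfolding adj_def
  proof (rule the_equality, intro conjI ballI)
    show "toeplitz (\<lambda>z. cnj (p z)) g \<in> bergman_space"
      by (rule toeplitz_in[OF p' g])
    fix f assume f: "f \<in> bergman_space"
    show "ip (toeplitz p f) g = ip f (toeplitz (\<lambda>z. cnj (p z)) g)"
      using toeplitz_ip[OF p f g] toeplitz_ip[OF p' g f] ip_mult_left[of p f g] by (metis ip_commute)
  next
    fix u assume u: "u \<in> bergman_space \<and> (\<forall>f\<in>bergman_space. ip (toeplitz p f) g = ip f u)"
    have "toeplitz (\<lambda>z. cnj (p z)) g = u"
      unfolding toeplitz_def
    proof (rule bergman_proj_eqI)
      show "sq_integrable (\<lambda>z. cnj (p z) * g z)"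
        by (intro sq_integrable_symbol_mult p' bergman_sq_integrable g)
      fix f assume f: "f \<in> bergman_space"
      have "ip f u = ip f (\<lambda>z. cnj (p z) * g z)"
        using u f toeplitz_ip[OF p f g] by (simp add: ip_mult_left)
      then show "ip (\<lambda>z. cnj (p z) * g z) f = ip u f"
        by (metis ip_commute)
    qed (use u in simp)
    then show "u = toeplitz (\<lambda>z. cnj (p z)) g" ..
  qed
qed

text \<open>In each of the two products the outer operator moves to the other side of the inner product as
  its adjoint, which leaves the inner product of an image of \<open>f\<close> with itself.\<close>

lemma ip_self_commutator_toeplitz:
  assumes p: "bounded_symbol p" and f: "f \<in> bergman_space"
  shows "ip (commutator (adj (toeplitz p)) (toeplitz p) f) f
       = of_real (norm_sq (toeplitz p f) - norm_sq (toeplitz (\<lambda>z. cnj (p z)) f))"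
proof -
  let ?T = "toeplitz p" and ?S = "toeplitz (\<lambda>z. cnj (p z))"
  note p' = bounded_symbol_cnj[OF p]
  note Tf = toeplitz_in[OF p f] and Sf = toeplitz_in[OF p' f]
  have "ip (commutator (adj ?T) ?T f) f = ip (\<lambda>z. ?S (?T f) z - ?T (?S f) z) f"
    by (simp add: commutator_def adj_toeplitz[OF p] f Tf)
  also have "\<dots> = ip (?S (?T f)) f - ip (?T (?S f)) f"
    by (intro ip_diff_left bergman_sq_integrable toeplitz_in p p' f)
  also have "ip (?S (?T f)) f = ip (?T f) (\<lambda>z. p z * f z)"
    using toeplitz_ip[OF p' Tf f] ip_mult_left[of "\<lambda>z. cnj (p z)" "?T f" f] by simp
  also have "\<dots> = ip (?T f) (?T f)"
    using toeplitz_ip[OF p f Tf] by (metis ip_commute)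
  also have "ip (?T (?S f)) f = ip (?S f) (\<lambda>z. cnj (p z) * f z)"
    using toeplitz_ip[OF p Sf f] ip_mult_left[of p "?S f" f] by simp
  also have "\<dots> = ip (?S f) (?S f)"
    using toeplitz_ip[OF p' f Sf] by (metis ip_commute)
  finally show ?thesis by (simp add: ip_self)
qed

lemma hyponormal_toeplitz_norm_le:
  assumes p: "bounded_symbol p" and "hyponormal (toeplitz p)" and f: "f \<in> bergman_space"
  shows "norm_sq (toeplitz (\<lambda>z. cnj (p z)) f) \<le> norm_sq (toeplitz p f)"
proof -
  have "ip (commutator (adj (toeplitz p)) (toeplitz p) f) f \<in> \<real>\<^sub>\<ge>\<^sub>0"
    using assms(2) f unfolding hyponormal_def positive_operator_def by blast
  then have "0 \<le> norm_sq (toeplitz p f) - norm_sq (toeplitz (\<lambda>z. cnj (p z)) f)"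
    by (simp only: ip_self_commutator_toeplitz[OF p f] nonneg_Reals_of_real_iff)
  then show ?thesis by simp
qed

definition disk_monomial :: "nat \<Rightarrow> complex \<Rightarrow> complex" where
  "disk_monomial n z = (if z \<in> unit_disk then z ^ n else 0)"

lemma bounded_symbol_monomial: "bounded_symbol (\<lambda>z. z ^ i * cnj z ^ j)"
proof -
  have "cmod (z ^ i * cnj z ^ j) \<le> 1" if "cmod z < 1" for z
    using that by (simp add: norm_mult norm_power power_le_one mult_le_one)
  then show ?thesis
    unfolding bounded_symbol_def by (auto intro!: exI[of _ 1])
qed

lemma bounded_symbol_add: 
  assumes "bounded_symbol p" "bounded_symbol q" shows "bounded_symbol (\<lambda>z. p z + q z)"
proof -
  obtain C D where "\<forall>z\<in>unit_disk. cmod (p z) \<le> C" "\<forall>z\<in>unit_disk. cmod (q z) \<le> D"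
    using assms by (auto simp: bounded_symbol_def)
  then have "\<forall>z\<in>unit_disk. cmod (p z + q z) \<le> C + D"
    by (meson add_mono norm_triangle_le)
  then show ?thesis
    using assms unfolding bounded_symbol_def by (auto intro!: exI[of _ "C + D"])
qed

lemma bounded_symbol_cmult: 
  assumes "bounded_symbol p" shows "bounded_symbol (\<lambda>z. c * p z)"
proof -
  obtain C where "\<forall>z\<in>unit_disk. cmod (p z) \<le> C"
    using assms by (auto simp: bounded_symbol_def)
  then have "\<forall>z\<in>unit_disk. cmod (c * p z) \<le> cmod c * C"
    by (auto simp: norm_mult intro: mult_left_mono)
  then show ?thesis
    using assms unfolding bounded_symbol_def by (auto intro!: exI[of _ "cmod c * C"])
qed

lemma sq_integrable_symbol:
  assumes "bounded_symbol p" shows "sq_integrable p"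
proof -
  have "sq_integrable (\<lambda>z. 1)" by (simp add: sq_integrable_def)
  from sq_integrable_symbol_mult[OF assms this] show ?thesis by simp
qed

lemma disk_monomial_bergman: "disk_monomial n \<in> bergman_space"
proof -
  have "sq_integrable (\<lambda>z. z ^ n * cnj z ^ 0)"
    by (intro sq_integrable_symbol bounded_symbol_monomial)
  then have "integrable disk_area (\<lambda>z. (cmod (z ^ n))\<^sup>2)"
    by (simp add: sq_integrable_def)
  moreover have hol: "disk_monomial n holomorphic_on unit_disk"
    by (rule holomorphic_transform[of "\<lambda>z. z ^ n"]) (auto simp: disk_monomial_def intro: holomorphic_intros)
  moreover have "disk_monomial n \<in> borel_measurable borel"
    unfolding disk_monomial_def mem_ball_0 by measurable
  ultimately have "integrable disk_area (\<lambda>z. (cmod (disk_monomial n z))\<^sup>2)"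
    by (elim integrable_cong_AE_imp) (auto simp: disk_monomial_def intro!: AE_disk_areaI)
  then show ?thesis using hol by (auto simp: bergman_space_def disk_monomial_def)
qed

section \<open>Projections of monomials and the coefficient bound\<close>

lemma mult_cnj_power: "(z * cnj z) ^ n = of_real (cmod z ^ (2 * n))"
  by (simp only: complex_norm_square[symmetric] power_mult of_real_power)

lemma integrable_monomial_mult:
  assumes "h \<in> bergman_space"
  shows "integrable disk_area (\<lambda>z. z ^ i * cnj z ^ j * h z)"
  using integrable_ip[OF bergman_sq_integrable[OF assms] sq_integrable_symbol[OF bounded_symbol_monomial[of j i]]]
  by (simp add: mult_ac)

text \<open>The monomial is the radial weight \<open>(cmod z) ^ (2 * n)\<close> times \<open>z\<close>, and the holomorphic function
  \<open>z * h z\<close> vanishes at the centre.\<close>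

lemma integral_degree_1_mult_bergman:
  assumes h: "h \<in> bergman_space"
  shows "(\<integral>z. z ^ Suc n * cnj z ^ n * h z \<partial>disk_area) = 0"
proof -
  have eq: "z ^ Suc n * cnj z ^ n * h z = of_real (cmod z ^ (2 * n)) * (z * h z)" for z
    unfolding mult_cnj_power[symmetric] by (simp add: power_mult_distrib mult_ac)
  have "(\<lambda>z. z * h z) holomorphic_on unit_disk"
    using h by (intro holomorphic_intros) (simp add: bergman_space_def)
  from radial_mean_value[OF this, of "\<lambda>r. of_real (r ^ (2 * n))"] show ?thesis
    using integrable_monomial_mult[OF h, of "Suc n" n] unfolding eq by simp
qed

text \<open>Rotation invariance picks out the linear Taylor coefficient of \<open>h\<close>: writing
  \<open>h z = h 0 + z * k z\<close>, the constant contributes nothing by the previous lemma (conjugated), and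
  the rest is the radial weight \<open>(cmod z) ^ (2 * n + 2)\<close> times the holomorphic \<open>k\<close>, where
  \<open>k 0 = deriv h 0\<close>.\<close>

lemma integral_degree_minus_1_mult_bergman:
  assumes h: "h \<in> bergman_space"
  shows "(\<integral>z. z ^ n * cnj z ^ Suc n * h z \<partial>disk_area) = deriv h 0 / (of_nat n + 2)"
proof -
  define k where "k z = (if z = 0 then deriv h 0 else (h z - h 0) / (z - 0))" for z
  have k: "k holomorphic_on unit_disk"
    unfolding k_def by (rule pole_lemma_open) (use h in \<open>auto simp: bergman_space_def\<close>)
  let ?w = "\<lambda>z::complex. z ^ n * cnj z ^ Suc n"
  \<comment> \<open>On the disk \<open>disk_monomial 0\<close> is 1; it is there so that the second term is a product with an
    element of the Bergman space.\<close>
  have eq: "of_real (cmod z ^ (2 * Suc n)) * k z = ?w z * h z - h 0 * (?w z * disk_monomial 0 z)"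
    if "z \<in> unit_disk" for z
    using that unfolding mult_cnj_power[symmetric]
    by (simp add: k_def disk_monomial_def power_mult_distrib field_simps)
  have int: "integrable disk_area (\<lambda>z. ?w z * h z - h 0 * (?w z * disk_monomial 0 z))"
    by (intro Bochner_Integration.integrable_diff integrable_mult_right integrable_monomial_mult h disk_monomial_bergman)
  note [measurable] = bergman_measurable[OF h]
  have [measurable]: "k \<in> borel_measurable borel"
    unfolding k_def by measurable
  have int_k: "integrable disk_area (\<lambda>z. of_real (cmod z ^ (2 * Suc n)) * k z)"
    by (rule integrable_cong_AE_imp[OF int]) (measurable, intro AE_disk_areaI eq[symmetric])
  have "(\<integral>z. ?w z * h z - h 0 * (?w z * disk_monomial 0 z) \<partial>disk_area)
      = (\<integral>z. of_real (cmod z ^ (2 * Suc n)) * k z \<partial>disk_area)"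
    by (intro integral_cong_AE AE_disk_areaI eq[symmetric] borel_measurable_integrable[OF int]) auto
  also have "\<dots> = k 0 * (\<integral>z. of_real (cmod z ^ (2 * Suc n)) \<partial>disk_area)"
    by (rule radial_mean_value[OF k _ int_k]) measurable
  also have "\<dots> = deriv h 0 / (of_nat n + 2)"
    using integral_cmod_power[of "Suc n"] by (simp add: k_def integral_complex_of_real del: mult_Suc_right of_real_power)
  finally have "(\<integral>z. ?w z * h z - h 0 * (?w z * disk_monomial 0 z) \<partial>disk_area) = deriv h 0 / (of_nat n + 2)" .
  moreover have "(\<integral>z. ?w z * disk_monomial 0 z \<partial>disk_area) = 0"
  proof -
    have "(\<integral>z. ?w z * disk_monomial 0 z \<partial>disk_area)
        = (\<integral>z. cnj (z ^ Suc n * cnj z ^ n * disk_monomial 0 z) \<partial>disk_area)"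
      by (intro Bochner_Integration.integral_cong) (auto simp: disk_monomial_def)
    also have "\<dots> = cnj (\<integral>z. z ^ Suc n * cnj z ^ n * disk_monomial 0 z \<partial>disk_area)"
      by (rule Bochner_Integration.integral_cnj)
    finally show ?thesis
      by (simp only: integral_degree_1_mult_bergman[OF disk_monomial_bergman] complex_cnj_zero)
  qed
  ultimately show ?thesis
    using integrable_monomial_mult[OF h, of n "Suc n"] integrable_monomial_mult[OF disk_monomial_bergman, of n "Suc n" 0]
    by simp
qed

lemma ip_degree_1_monomial:
  assumes h: "h \<in> bergman_space"
  shows "ip (\<lambda>z. z ^ Suc n * cnj z ^ n) h = cnj (deriv h 0) / (of_nat n + 2)"
proof -
  have "ip (\<lambda>z. z ^ Suc n * cnj z ^ n) h = (\<integral>z. cnj (z ^ n * cnj z ^ Suc n * h z) \<partial>disk_area)"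
    unfolding ip_def by (simp add: mult_ac)
  then show ?thesis
    by (simp only: Bochner_Integration.integral_cnj integral_degree_minus_1_mult_bergman[OF h]) simp
qed

lemma ip_degree_minus_1_monomial:
  assumes h: "h \<in> bergman_space"
  shows "ip (\<lambda>z. z ^ n * cnj z ^ Suc n) h = 0"
proof -
  have "ip (\<lambda>z. z ^ n * cnj z ^ Suc n) h = (\<integral>z. cnj (z ^ Suc n * cnj z ^ n * h z) \<partial>disk_area)"
    unfolding ip_def by (simp add: mult_ac)
  then show ?thesis
    by (simp only: Bochner_Integration.integral_cnj integral_degree_1_mult_bergman[OF h]) simp
qed

text \<open>The degree of a monomial in \<open>z\<close> and \<open>cnj z\<close> is its behaviour under rotations. A monomial of degree 1
  is seen by the Bergman space only through the linear Taylor coefficient, hence projects to a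
  multiple of \<open>z\<close>; one of degree -1 is orthogonal to the space and projects to 0. The factor
  \<open>2 / (n + 2)\<close> is the ratio of the integrals of \<open>(cmod z) ^ (2 * n + 2)\<close> and \<open>(cmod z)\<^sup>2\<close>.\<close>

lemma toeplitz_disk_monomial_0:
  "toeplitz (\<lambda>z. c * (z ^ Suc n * cnj z ^ n) + b * (z ^ k * cnj z ^ Suc k)) (disk_monomial 0)
     = (\<lambda>z. (2 * c / (of_nat n + 2)) * disk_monomial 1 z)"
  unfolding toeplitz_def
proof (rule bergman_proj_eqI)
  let ?p = "\<lambda>z. c * (z ^ Suc n * cnj z ^ n) + b * (z ^ k * cnj z ^ Suc k)"
  note sym = bounded_symbol_cmult[OF bounded_symbol_monomial]
  have p: "bounded_symbol ?p"
    by (intro bounded_symbol_add sym)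
  show sq: "sq_integrable (\<lambda>z. ?p z * disk_monomial 0 z)"
    by (intro sq_integrable_symbol_mult p bergman_sq_integrable disk_monomial_bergman)
  show "(\<lambda>z. (2 * c / (of_nat n + 2)) * disk_monomial 1 z) \<in> bergman_space"
    by (intro bergman_cmult disk_monomial_bergman)
  fix h assume h: "h \<in> bergman_space"
  note hsq = bergman_sq_integrable[OF h]
  have "ip (\<lambda>z. ?p z * disk_monomial 0 z) h = ip ?p h"
    by (intro ip_cong sq hsq sq_integrable_symbol p) (auto simp: disk_monomial_def)
  also have "\<dots> = ip (\<lambda>z. c * (z ^ Suc n * cnj z ^ n)) h + ip (\<lambda>z. b * (z ^ k * cnj z ^ Suc k)) h"
    by (intro ip_add_left sq_integrable_symbol sym hsq)
  also have "\<dots> = c * (cnj (deriv h 0) / (of_nat n + 2))"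
    by (simp only: ip_cmult_left ip_degree_1_monomial[OF h] ip_degree_minus_1_monomial[OF h]) simp
  also have "\<dots> = (2 * c / (of_nat n + 2)) * ip (disk_monomial 1) h"
  proof -
    have "ip (disk_monomial 1) h = ip (\<lambda>z. z ^ Suc 0 * cnj z ^ 0) h"
      by (intro ip_cong hsq bergman_sq_integrable disk_monomial_bergman sq_integrable_symbol bounded_symbol_monomial)
         (auto simp: disk_monomial_def)
    also have "\<dots> = cnj (deriv h 0) / 2"
      using ip_degree_1_monomial[OF h, of 0] by simp
    finally have *: "ip (disk_monomial 1) h = cnj (deriv h 0) / 2" .
    show ?thesis unfolding * by (simp only: times_divide_eq_left times_divide_eq_right mult_ac) simp
  qed
  also have "\<dots> = ip (\<lambda>z. (2 * c / (of_nat n + 2)) * disk_monomial 1 z) h"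
    by (rule ip_cmult_left[symmetric])
  finally show "ip (\<lambda>z. ?p z * disk_monomial 0 z) h = ip (\<lambda>z. (2 * c / (of_nat n + 2)) * disk_monomial 1 z) h" .
qed

lemma norm_sq_disk_monomial_1: "norm_sq (disk_monomial 1) > 0"
proof -
  have "disk_monomial 1 (1/2) \<noteq> 0"
    by (simp add: disk_monomial_def)
  then have "norm_sq (disk_monomial 1) \<noteq> 0"
    using bergman_norm_sq_eq_0[OF disk_monomial_bergman, of 1] by metis
  then show ?thesis using norm_sq_nonneg[of "disk_monomial 1"] by simp
qed

theorem theorem1p6:
  fixes m q :: nat and a :: complex
  assumes "m \<ge> 1" and "q \<ge> 1" and "int m - int q - 1 \<ge> 0"
    and "hyponormal (toeplitz (\<lambda>z. z ^ m * cnj z ^ (m - 1) + a * cnj z ^ (m - q) * z ^ (m - q - 1)))"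
  shows "cmod a \<le> (real m - real q + 1) / (real m + 1)"
proof -
  obtain n where m: "m = Suc n" using assms(1) by (cases m) auto
  obtain k where mq: "m - q = Suc k" using assms(3) by (cases "m - q") auto
  have k: "real m - real q = real k + 1" using mq by linarith
  \<comment> \<open>The symbol and its conjugate, both sorted into a part of degree 1 and a part of degree -1;
    the coefficients 1 bring them into the form of \<open>toeplitz_disk_monomial_0\<close>.\<close>
  define p where "p = (\<lambda>z. 1 * (z ^ Suc n * cnj z ^ n) + a * (z ^ k * cnj z ^ Suc k))"
  define p' where "p' = (\<lambda>z. cnj a * (z ^ Suc k * cnj z ^ k) + 1 * (z ^ n * cnj z ^ Suc n))"
  have p: "bounded_symbol p"
    unfolding p_def by (intro bounded_symbol_add bounded_symbol_cmult bounded_symbol_monomial)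
  have p': "(\<lambda>z. cnj (p z)) = p'"
    by (simp add: p_def p'_def fun_eq_iff mult_ac add.commute)
  have hyp: "hyponormal (toeplitz p)"
  proof -
    have "p = (\<lambda>z. z ^ m * cnj z ^ (m - 1) + a * cnj z ^ (m - q) * z ^ (m - q - 1))"
      unfolding p_def mq by (simp add: m fun_eq_iff mult_ac)
    then show ?thesis using assms(4) by simp
  qed
  have "norm_sq (toeplitz p' (disk_monomial 0)) \<le> norm_sq (toeplitz p (disk_monomial 0))"
    using hyponormal_toeplitz_norm_le[OF p hyp disk_monomial_bergman] unfolding p' .
  then have "(cmod (2 * cnj a / (of_nat k + 2)))\<^sup>2 \<le> (cmod (2 * 1 / (of_nat n + 2)))\<^sup>2"
    unfolding p_def p'_def toeplitz_disk_monomial_0 norm_sq_cmult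
    using norm_sq_disk_monomial_1 by (simp only: mult_le_cancel_right_pos)
  then have "cmod (2 * cnj a / (of_nat k + 2)) \<le> cmod (2 * 1 / (of_nat n + 2))"
    by (rule power2_le_imp_le) simp
  moreover have "cmod (of_nat j + 2) = real j + 2" for j
    using norm_of_nat[of "j + 2", where 'a = complex] by (simp add: add.commute)
  ultimately have "cmod a / (real k + 2) \<le> 1 / (real n + 2)"
    by (simp add: norm_divide norm_mult)
  then have "cmod a \<le> (real k + 2) / (real n + 2)"
    by (simp add: field_simps)
  also have "\<dots> = (real m - real q + 1) / (real m + 1)"
    by (simp only: k) (simp add: m add.commute)
  finally show ?thesis .
qed

end
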